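(* Let $\mathbb{C}$ be a category with pullbacks, let $F:\mathbb{C}\rightarrow\mathbb{X}$ be left adjoint to $G:\mathbb{X}\rightarrow\mathbb{C}$ with unit $\theta:1_\mathbb{C}\rightarrow GF=\mathcal{F}$, and let $(\mathcal{E},\mathcal{M})$ be a prefactorization system on $\mathbb{C}$ such that, for every $C\in\mathbb{C}$, $\theta_C=\mu_C\circ\eta_C:C\rightarrow\mathcal{I}(C)\rightarrow\mathcal{F}(C)$ with $\eta_C\in\mathcal{E}$, $\mu_C\in\mathcal{M}$ and $\eta_C$ an epimorphism. Let $I:\mathbb{C}\rightarrow\mathcal{M}(F)$, left adjoint to the full inclusion $H:\mathcal{M}(F)\rightarrow\mathbb{C}$, be the resulting reflection with unit $\eta$. Consider the conditions: (a) $\mathcal{F}=GF$ preserves, for every $C\in\mathbb{C}$ and every morphism $g:A\rightarrow\mathcal{I}(C)$, the pullback square of $\eta_C:C\rightarrow\mathcal{I}(C)$ along $g$, i.e. the square with vertices $A\times_{\mathcal{I}(C)}C$, $C$, $A$, $\mathcal{I}(C)$ and with left side $g^*(\eta_C):A\times_{\mathcal{I}(C)}C\rightarrow A$; (b) $\eta_C\in\mathcal{E}'$ for every $C\in\mathbb{C}$, where $\mathcal{E}'$ is the largest subclass of $\mathcal{E}$ which is closed under pullbacks. If (a) and (b) hold, then the reflection $I\dashv H$ has stable units. Moreover, $I\dashv H$ has stable units only if condition (a) holds.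
   Context: For morphisms $e,m$ write $e\downarrow m$ if for every commutative square $v\circ e=m\circ u$ there is a unique $w$ with $w\circ e=u$ and $m\circ w=v$. A prefactorization system $(\mathcal{E},\mathcal{M})$ is a pair of classes of morphisms with $\mathcal{E}=\{e\mid e\downarrow m \ \forall m\in\mathcal{M}\}$ and $\mathcal{M}=\{m\mid e\downarrow m\ \forall e\in\mathcal{E}\}$. The assignment $C\mapsto\mathcal{I}(C)$ extends to an endofunctor $\mathcal{I}$ of $\mathbb{C}$: for $f:C\rightarrow C'$, $\mathcal{I}f$ is the unique morphism with $\mathcal{I}f\circ\eta_C=\eta_{C'}\circ f$ and $\mu_{C'}\circ\mathcal{I}f=\mathcal{F}f\circ\mu_C$. $\mathcal{M}(F)$ is the full replete subcategory of $\mathbb{C}$ determined by the objects $M$ with $\theta_M\in\mathcal{M}$ (equivalently, with $\eta_M$ an isomorphism); it is reflective with reflector $I$ (the corestriction of $\mathcal{I}$, so $\mathcal{I}=HI$) and unit $\eta$. For a class $\mathcal{S}$ of morphisms, the largest subclass of $\mathcal{S}$ closed under pullbacks consists of those morphisms all of whose pullbacks (along arbitrary morphisms into the codomain) lie in $\mathcal{S}$. The reflection $I\dashv H$ has stable units if every unit morphism $\eta_C$ belongs to $\mathcal{E}'_I$, the largest pullback-closed subclass of $\mathcal{E}_I$, where $\mathcal{E}_I$ is the class of morphisms $f$ of $\mathbb{C}$ such that $If$ is an isomorphism; equivalently, $I(g^*(\eta_C))$ is an isomorphism for all $C$ and all $g:A\rightarrow HI(C)$. *)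

theory Defs
  imports Main
begin

record ('o, 'a) cat =
  Obj :: "'o set"
  Arr :: "'a set"
  Dom :: "'a \<Rightarrow> 'o"
  Cod :: "'a \<Rightarrow> 'o"
  Idt :: "'o \<Rightarrow> 'a"
  Comp :: "'a \<Rightarrow> 'a \<Rightarrow> 'a"  (infixl \<open>\<cdot>\<index>\<close> 70)

definition hom :: "('o, 'a) cat \<Rightarrow> 'o \<Rightarrow> 'o \<Rightarrow> 'a set" where
  "hom C a b = {f \<in> Arr C. Dom C f = a \<and> Cod C f = b}"

(* g \<cdot> f is composition in the usual order (f first); it is unconstrained unless Dom g = Cod f. *)
locale category =
  fixes C :: "('o, 'a) cat" (structure)
  assumes dom_Obj: "f \<in> Arr C \<Longrightarrow> Dom C f \<in> Obj C"
    and cod_Obj: "f \<in> Arr C \<Longrightarrow> Cod C f \<in> Obj C"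
    and idt_hom: "a \<in> Obj C \<Longrightarrow> Idt C a \<in> hom C a a"
    and comp_hom: "\<lbrakk>f \<in> hom C a b; g \<in> hom C b c\<rbrakk> \<Longrightarrow> g \<cdot> f \<in> hom C a c"
    and comp_idt: "f \<in> hom C a b \<Longrightarrow> f \<cdot> Idt C a = f"
    and idt_comp: "f \<in> hom C a b \<Longrightarrow> Idt C b \<cdot> f = f"
    and comp_assoc: "\<lbrakk>f \<in> hom C a b; g \<in> hom C b c; h \<in> hom C c d\<rbrakk> \<Longrightarrow>
      (h \<cdot> g) \<cdot> f = h \<cdot> (g \<cdot> f)"

definition is_iso :: "('o, 'a) cat \<Rightarrow> 'a \<Rightarrow> bool" where
  "is_iso C f \<longleftrightarrow> f \<in> Arr C \<and>
    (\<exists>g \<in> hom C (Cod C f) (Dom C f).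
      g \<cdot>\<^bsub>C\<^esub> f = Idt C (Dom C f) \<and> f \<cdot>\<^bsub>C\<^esub> g = Idt C (Cod C f))"

definition is_epi :: "('o, 'a) cat \<Rightarrow> 'a \<Rightarrow> bool" where
  "is_epi C e \<longleftrightarrow> e \<in> Arr C \<and>
    (\<forall>b. \<forall>g \<in> hom C (Cod C e) b. \<forall>h \<in> hom C (Cod C e) b.
      g \<cdot>\<^bsub>C\<^esub> e = h \<cdot>\<^bsub>C\<^esub> e \<longrightarrow> g = h)"

(* The commutative square  f \<cdot> p = g \<cdot> q  is a pullback; p is then a pullback of g along f. *)
definition is_pullback :: "('o, 'a) cat \<Rightarrow> 'a \<Rightarrow> 'a \<Rightarrow> 'a \<Rightarrow> 'a \<Rightarrow> bool" where
  "is_pullback C p q f g \<longleftrightarrow>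
    p \<in> Arr C \<and> q \<in> Arr C \<and> f \<in> Arr C \<and> g \<in> Arr C \<and>
    Dom C p = Dom C q \<and> Cod C p = Dom C f \<and> Cod C q = Dom C g \<and> Cod C f = Cod C g \<and>
    f \<cdot>\<^bsub>C\<^esub> p = g \<cdot>\<^bsub>C\<^esub> q \<and>
    (\<forall>z. \<forall>x \<in> hom C z (Dom C f). \<forall>y \<in> hom C z (Dom C g).
      f \<cdot>\<^bsub>C\<^esub> x = g \<cdot>\<^bsub>C\<^esub> y \<longrightarrow>
      (\<exists>!u. u \<in> hom C z (Dom C p) \<and> p \<cdot>\<^bsub>C\<^esub> u = x \<and> q \<cdot>\<^bsub>C\<^esub> u = y))"

definition has_pullbacks :: "('o, 'a) cat \<Rightarrow> bool" where
  "has_pullbacks C \<longleftrightarrow>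
    (\<forall>f \<in> Arr C. \<forall>g \<in> Arr C. Cod C f = Cod C g \<longrightarrow> (\<exists>p q. is_pullback C p q f g))"

record ('o, 'a, 'p, 'b) functor_data =
  omap :: "'o \<Rightarrow> 'p"
  amap :: "'a \<Rightarrow> 'b"

definition is_functor ::
    "('o, 'a) cat \<Rightarrow> ('p, 'b) cat \<Rightarrow> ('o, 'a, 'p, 'b) functor_data \<Rightarrow> bool" where
  "is_functor C D F \<longleftrightarrow>
    (\<forall>a \<in> Obj C. omap F a \<in> Obj D) \<and>
    (\<forall>a b. \<forall>f \<in> hom C a b. amap F f \<in> hom D (omap F a) (omap F b)) \<and>
    (\<forall>a \<in> Obj C. amap F (Idt C a) = Idt D (omap F a)) \<and>
    (\<forall>a b c. \<forall>f \<in> hom C a b. \<forall>g \<in> hom C b c.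
      amap F (g \<cdot>\<^bsub>C\<^esub> f) = amap F g \<cdot>\<^bsub>D\<^esub> amap F f)"

definition functor_comp :: "('p, 'b, 'q, 'c) functor_data \<Rightarrow> ('o, 'a, 'p, 'b) functor_data
    \<Rightarrow> ('o, 'a, 'q, 'c) functor_data"  (infixl \<open>\<circ>\<^sub>F\<close> 70) where
  "G \<circ>\<^sub>F F = \<lparr>omap = omap G \<circ> omap F, amap = amap G \<circ> amap F\<rparr>"

(* Functors carry no domain or codomain, so this is also the inclusion of any subcategory. *)
definition id_functor :: "('o, 'a, 'o, 'a) functor_data" where
  "id_functor = \<lparr>omap = (\<lambda>x. x), amap = (\<lambda>f. f)\<rparr>"

definition is_nat_trans :: "('o, 'a) cat \<Rightarrow> ('p, 'b) cat \<Rightarrow> ('o, 'a, 'p, 'b) functor_data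
    \<Rightarrow> ('o, 'a, 'p, 'b) functor_data \<Rightarrow> ('o \<Rightarrow> 'b) \<Rightarrow> bool" where
  "is_nat_trans C D F G \<tau> \<longleftrightarrow>
    (\<forall>a \<in> Obj C. \<tau> a \<in> hom D (omap F a) (omap G a)) \<and>
    (\<forall>a b. \<forall>f \<in> hom C a b. \<tau> b \<cdot>\<^bsub>D\<^esub> amap F f = amap G f \<cdot>\<^bsub>D\<^esub> \<tau> a)"

(* F : C \<rightarrow> X is left adjoint to G : X \<rightarrow> C with unit \<theta>; the counit \<epsilon> is determined by \<theta>. *)
definition is_adjunction :: "('o, 'a) cat \<Rightarrow> ('p, 'b) cat \<Rightarrow> ('o, 'a, 'p, 'b) functor_data
    \<Rightarrow> ('p, 'b, 'o, 'a) functor_data \<Rightarrow> ('o \<Rightarrow> 'a) \<Rightarrow> bool" where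
  "is_adjunction C X F G \<theta> \<longleftrightarrow>
    category C \<and> category X \<and> is_functor C X F \<and> is_functor X C G \<and>
    is_nat_trans C C id_functor (G \<circ>\<^sub>F F) \<theta> \<and>
    (\<exists>\<epsilon>. is_nat_trans X X (F \<circ>\<^sub>F G) id_functor \<epsilon> \<and>
      (\<forall>a \<in> Obj C. \<epsilon> (omap F a) \<cdot>\<^bsub>X\<^esub> amap F (\<theta> a) = Idt X (omap F a)) \<and>
      (\<forall>x \<in> Obj X. amap G (\<epsilon> x) \<cdot>\<^bsub>C\<^esub> \<theta> (omap G x) = Idt C (omap G x)))"

definition orth :: "('o, 'a) cat \<Rightarrow> 'a \<Rightarrow> 'a \<Rightarrow> bool" where
  "orth C e m \<longleftrightarrow>
    (\<forall>u \<in> hom C (Dom C e) (Dom C m). \<forall>v \<in> hom C (Cod C e) (Cod C m).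
      v \<cdot>\<^bsub>C\<^esub> e = m \<cdot>\<^bsub>C\<^esub> u \<longrightarrow>
      (\<exists>!w. w \<in> hom C (Cod C e) (Dom C m) \<and> w \<cdot>\<^bsub>C\<^esub> e = u \<and> m \<cdot>\<^bsub>C\<^esub> w = v))"

definition prefactorization_system :: "('o, 'a) cat \<Rightarrow> 'a set \<Rightarrow> 'a set \<Rightarrow> bool" where
  "prefactorization_system C \<E> \<M> \<longleftrightarrow>
    \<E> = {e \<in> Arr C. \<forall>m \<in> \<M>. orth C e m} \<and>
    \<M> = {m \<in> Arr C. \<forall>e \<in> \<E>. orth C e m}"

definition pullback_closed :: "('o, 'a) cat \<Rightarrow> 'a set \<Rightarrow> bool" where
  "pullback_closed C \<S> \<longleftrightarrow> (\<forall>p q f g. is_pullback C p q f g \<and> g \<in> \<S> \<longrightarrow> p \<in> \<S>)"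

definition largest_pullback_closed :: "('o, 'a) cat \<Rightarrow> 'a set \<Rightarrow> 'a set" where
  "largest_pullback_closed C \<S> = \<Union>{\<T>. \<T> \<subseteq> \<S> \<and> pullback_closed C \<T>}"

lemma largest_pullback_closed_props:
  "largest_pullback_closed C \<S> \<subseteq> \<S>"
  "pullback_closed C (largest_pullback_closed C \<S>)"
  "\<lbrakk>\<T> \<subseteq> \<S>; pullback_closed C \<T>\<rbrakk> \<Longrightarrow> \<T> \<subseteq> largest_pullback_closed C \<S>"
  unfolding largest_pullback_closed_def pullback_closed_def by blast+

definition full_subcat :: "('o, 'a) cat \<Rightarrow> ('o \<Rightarrow> bool) \<Rightarrow> ('o, 'a) cat" where
  "full_subcat C P =
    C\<lparr>Obj := {a \<in> Obj C. P a}, Arr := {f \<in> Arr C. P (Dom C f) \<and> P (Cod C f)}\<rparr>"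

(* The category called M(F), where \<theta> is the unit of the adjunction with left adjoint F. *)
definition M_subcat :: "('o, 'a) cat \<Rightarrow> 'a set \<Rightarrow> ('o \<Rightarrow> 'a) \<Rightarrow> ('o, 'a) cat" where
  "M_subcat C \<M> \<theta> = full_subcat C (\<lambda>a. \<theta> a \<in> \<M>)"

(* The endofunctor \<I> of C, with T = GF and \<theta> = \<mu> \<cdot> \<eta> the chosen factorization through \<I>(a).
   Read as a functor from C to M_subcat C \<M> \<theta>, the same data is the reflector I. *)
definition I_functor :: "('o, 'a) cat \<Rightarrow> ('o, 'a, 'o, 'a) functor_data \<Rightarrow> ('o \<Rightarrow> 'o)
    \<Rightarrow> ('o \<Rightarrow> 'a) \<Rightarrow> ('o \<Rightarrow> 'a) \<Rightarrow> ('o, 'a, 'o, 'a) functor_data" where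
  "I_functor C T \<I> \<eta> \<mu> = \<lparr>omap = \<I>, amap = (\<lambda>f. THE h.
      h \<in> hom C (\<I> (Dom C f)) (\<I> (Cod C f)) \<and>
      h \<cdot>\<^bsub>C\<^esub> \<eta> (Dom C f) = \<eta> (Cod C f) \<cdot>\<^bsub>C\<^esub> f \<and>
      \<mu> (Cod C f) \<cdot>\<^bsub>C\<^esub> h = amap T f \<cdot>\<^bsub>C\<^esub> \<mu> (Dom C f))\<rparr>"

(* I_functor is indeed a reflector onto M_subcat C \<M> \<theta> with unit \<eta>. *)
lemma I_functor_reflection:
  fixes C :: "('o, 'a) cat" and X :: "('p, 'b) cat"
  assumes adj: "is_adjunction C X F G \<theta>"
    and pre: "prefactorization_system C \<E> \<M>"
    and eta: "\<And>c. c \<in> Obj C \<Longrightarrow> \<eta> c \<in> hom C c (\<I> c)"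
    and mu: "\<And>c. c \<in> Obj C \<Longrightarrow> \<mu> c \<in> hom C (\<I> c) (omap (G \<circ>\<^sub>F F) c)"
    and fac: "\<And>c. c \<in> Obj C \<Longrightarrow> \<theta> c = \<mu> c \<cdot>\<^bsub>C\<^esub> \<eta> c"
    and etaE: "\<And>c. c \<in> Obj C \<Longrightarrow> \<eta> c \<in> \<E>"
    and muM: "\<And>c. c \<in> Obj C \<Longrightarrow> \<mu> c \<in> \<M>"
    and epi: "\<And>c. c \<in> Obj C \<Longrightarrow> is_epi C (\<eta> c)"
  shows "is_adjunction C (M_subcat C \<M> \<theta>) (I_functor C (G \<circ>\<^sub>F F) \<I> \<eta> \<mu>) id_functor \<eta>"
proof -
  define T where "T = G \<circ>\<^sub>F F"
  define I where "I = I_functor C T \<I> \<eta> \<mu>"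
  define B where "B = M_subcat C \<M> \<theta>"
  interpret C: category C using adj by (simp add: is_adjunction_def)
  interpret X: category X using adj by (simp add: is_adjunction_def)
  have FF: "is_functor C X F" and GG: "is_functor X C G"
    and th: "is_nat_trans C C id_functor T \<theta>"
    using adj by (simp_all add: is_adjunction_def T_def)
  obtain \<epsilon> where eps: "is_nat_trans X X (F \<circ>\<^sub>F G) id_functor \<epsilon>"
    and tri: "\<And>x. x \<in> Obj X \<Longrightarrow> amap G (\<epsilon> x) \<cdot>\<^bsub>C\<^esub> \<theta> (omap G x) = Idt C (omap G x)"
    using adj unfolding is_adjunction_def by blast
  have mu': "\<mu> c \<in> hom C (\<I> c) (omap T c)" if "c \<in> Obj C" for c using mu[OF that] by (simp add: T_def)
  have Tmap: "amap T f \<in> hom C (omap T a) (omap T b)" if "f \<in> hom C a b" for a b f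
    using that FF GG by (auto simp: T_def functor_comp_def is_functor_def)
  have homO: "a \<in> Obj C" "b \<in> Obj C" if "f \<in> hom C a b" for a b f
    using that C.dom_Obj C.cod_Obj by (auto simp: hom_def)
  have thn: "\<theta> b \<cdot>\<^bsub>C\<^esub> f = amap T f \<cdot>\<^bsub>C\<^esub> \<theta> a" if "f \<in> hom C a b" for a b f
    using th that by (simp add: is_nat_trans_def id_functor_def)
  have thh: "\<theta> c \<in> hom C c (omap T c)" if "c \<in> Obj C" for c
    using th that by (simp add: is_nat_trans_def id_functor_def)
  have orth: "\<exists>!w. w \<in> hom C b c \<and> w \<cdot>\<^bsub>C\<^esub> e = u \<and> m \<cdot>\<^bsub>C\<^esub> w = v"
    if "e \<in> \<E>" "m \<in> \<M>" "e \<in> hom C a b" "m \<in> hom C c d" "u \<in> hom C a c" "v \<in> hom C b d"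
      "v \<cdot>\<^bsub>C\<^esub> e = m \<cdot>\<^bsub>C\<^esub> u" for e m u v a b c d
  proof -
    have "orth C e m" using pre that(1,2) unfolding prefactorization_system_def by blast
    then show ?thesis using that unfolding orth_def hom_def by auto
  qed
  have epiD: "g = h" if "c \<in> Obj C" "g \<in> hom C (\<I> c) b" "h \<in> hom C (\<I> c) b"
    "g \<cdot>\<^bsub>C\<^esub> \<eta> c = h \<cdot>\<^bsub>C\<^esub> \<eta> c" for c g h b
    using epi[OF that(1)] eta[OF that(1)] that(2-) by (auto simp: is_epi_def hom_def)
  have Iex: "\<exists>!h. h \<in> hom C (\<I> a) (\<I> b) \<and> h \<cdot>\<^bsub>C\<^esub> \<eta> a = \<eta> b \<cdot>\<^bsub>C\<^esub> f \<and>
      \<mu> b \<cdot>\<^bsub>C\<^esub> h = amap T f \<cdot>\<^bsub>C\<^esub> \<mu> a" if f: "f \<in> hom C a b" for a b f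
  proof (rule orth)
    note O = homO[OF f]
    show "\<eta> a \<in> \<E>" "\<mu> b \<in> \<M>" "\<eta> a \<in> hom C a (\<I> a)" "\<mu> b \<in> hom C (\<I> b) (omap T b)"
      using O etaE muM eta mu' by auto
    show "\<eta> b \<cdot>\<^bsub>C\<^esub> f \<in> hom C a (\<I> b)" using C.comp_hom f eta O by blast
    show "amap T f \<cdot>\<^bsub>C\<^esub> \<mu> a \<in> hom C (\<I> a) (omap T b)" using C.comp_hom Tmap[OF f] mu' O by blast
    have "(amap T f \<cdot>\<^bsub>C\<^esub> \<mu> a) \<cdot>\<^bsub>C\<^esub> \<eta> a = amap T f \<cdot>\<^bsub>C\<^esub> \<theta> a"
      using C.comp_assoc[OF eta mu' Tmap[OF f]] O fac by simp
    also have "\<dots> = \<theta> b \<cdot>\<^bsub>C\<^esub> f" using thn[OF f] by simp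
    also have "\<dots> = \<mu> b \<cdot>\<^bsub>C\<^esub> (\<eta> b \<cdot>\<^bsub>C\<^esub> f)" using C.comp_assoc[OF f eta mu'] O fac by simp
    finally show "(amap T f \<cdot>\<^bsub>C\<^esub> \<mu> a) \<cdot>\<^bsub>C\<^esub> \<eta> a = \<mu> b \<cdot>\<^bsub>C\<^esub> (\<eta> b \<cdot>\<^bsub>C\<^esub> f)" .
  qed
  have Io: "omap I c = \<I> c" for c by (simp add: I_def I_functor_def)
  have If: "amap I f \<in> hom C (\<I> a) (\<I> b)" "amap I f \<cdot>\<^bsub>C\<^esub> \<eta> a = \<eta> b \<cdot>\<^bsub>C\<^esub> f"
    if f: "f \<in> hom C a b" for a b f
  proof -
    have "Dom C f = a" "Cod C f = b" using f by (auto simp: hom_def)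
    then have "amap I f = (THE h. h \<in> hom C (\<I> a) (\<I> b) \<and> h \<cdot>\<^bsub>C\<^esub> \<eta> a = \<eta> b \<cdot>\<^bsub>C\<^esub> f \<and>
      \<mu> b \<cdot>\<^bsub>C\<^esub> h = amap T f \<cdot>\<^bsub>C\<^esub> \<mu> a)"
      by (simp add: I_def I_functor_def)
    with theI'[OF Iex[OF f]] show "amap I f \<in> hom C (\<I> a) (\<I> b)"
      "amap I f \<cdot>\<^bsub>C\<^esub> \<eta> a = \<eta> b \<cdot>\<^bsub>C\<^esub> f" by simp_all
  qed
  have IO: "\<I> c \<in> Obj C" if "c \<in> Obj C" for c using homO(2)[OF eta[OF that]] .
  \<comment> \<open>a retraction of \<open>\<eta> m\<close> is its inverse\<close>
  have inv: "\<eta> m \<cdot>\<^bsub>C\<^esub> r = Idt C (\<I> m)"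
    if m: "m \<in> Obj C" and r: "r \<in> hom C (\<I> m) m" "r \<cdot>\<^bsub>C\<^esub> \<eta> m = Idt C m" for m r
  proof (rule epiD[OF m])
    show "\<eta> m \<cdot>\<^bsub>C\<^esub> r \<in> hom C (\<I> m) (\<I> m)" using C.comp_hom r(1) eta m by blast
    show "Idt C (\<I> m) \<in> hom C (\<I> m) (\<I> m)" using C.idt_hom IO m by blast
    show "(\<eta> m \<cdot>\<^bsub>C\<^esub> r) \<cdot>\<^bsub>C\<^esub> \<eta> m = Idt C (\<I> m) \<cdot>\<^bsub>C\<^esub> \<eta> m"
      using C.comp_assoc[OF eta[OF m] r(1) eta[OF m]] r(2) C.comp_idt[OF eta[OF m]]
        C.idt_comp[OF eta[OF m]] by simp
  qed
  have ret: "\<exists>r. r \<in> hom C (\<I> m) m \<and> r \<cdot>\<^bsub>C\<^esub> \<eta> m = Idt C m"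
    if m: "m \<in> Obj C" "\<theta> m \<in> \<M>" for m
  proof -
    have "\<exists>!w. w \<in> hom C (\<I> m) m \<and> w \<cdot>\<^bsub>C\<^esub> \<eta> m = Idt C m \<and> \<theta> m \<cdot>\<^bsub>C\<^esub> w = \<mu> m"
      by (rule orth[OF etaE[OF m(1)] m(2) eta[OF m(1)] thh[OF m(1)] C.idt_hom[OF m(1)] mu'[OF m(1)]])
        (use fac[OF m(1)] C.comp_idt[OF thh[OF m(1)]] in simp)
    then show ?thesis by blast
  qed
  \<comment> \<open>\<open>\<I> c\<close> lies in \<open>M(F)\<close>\<close>
  have IM: "\<theta> (\<I> c) \<in> \<M>" if c: "c \<in> Obj C" for c
  proof -
    let ?d = "\<I> c"
    have d: "?d \<in> Obj C" using IO[OF c] .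
    let ?x = "omap F c"
    have x: "?x \<in> Obj X" using FF c by (simp add: is_functor_def)
    have Fm: "amap F (\<mu> c) \<in> hom X (omap F ?d) (omap F (omap G ?x))"
      using FF mu'[OF c] unfolding is_functor_def T_def functor_comp_def by simp
    have ex: "\<epsilon> ?x \<in> hom X (omap F (omap G ?x)) ?x"
      using eps x by (simp add: is_nat_trans_def functor_comp_def id_functor_def)
    define v where "v = amap G (\<epsilon> ?x) \<cdot>\<^bsub>C\<^esub> amap T (\<mu> c)"
    have Gex: "amap G (\<epsilon> ?x) \<in> hom C (omap T (omap T c)) (omap T c)"
      using GG ex unfolding is_functor_def T_def functor_comp_def by simp
    have Tm: "amap T (\<mu> c) \<in> hom C (omap T ?d) (omap T (omap T c))" using Tmap[OF mu'[OF c]] .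
    have v: "v \<in> hom C (omap T ?d) (omap T c)" unfolding v_def by (rule C.comp_hom[OF Tm Gex])
    have TO: "omap T c \<in> Obj C" using homO(2)[OF mu'[OF c]] .
    have "v \<cdot>\<^bsub>C\<^esub> \<theta> ?d = amap G (\<epsilon> ?x) \<cdot>\<^bsub>C\<^esub> (amap T (\<mu> c) \<cdot>\<^bsub>C\<^esub> \<theta> ?d)"
      unfolding v_def by (rule C.comp_assoc[OF thh[OF d] Tm Gex])
    also have "\<dots> = amap G (\<epsilon> ?x) \<cdot>\<^bsub>C\<^esub> (\<theta> (omap T c) \<cdot>\<^bsub>C\<^esub> \<mu> c)"
      using thn[OF mu'[OF c]] by simp
    also have "\<dots> = (amap G (\<epsilon> ?x) \<cdot>\<^bsub>C\<^esub> \<theta> (omap T c)) \<cdot>\<^bsub>C\<^esub> \<mu> c"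
      using C.comp_assoc[OF mu'[OF c] thh[OF TO] Gex] by simp
    also have "\<dots> = \<mu> c"
      using tri[OF x] C.idt_comp[OF mu'[OF c]] by (simp add: T_def functor_comp_def)
    finally have vth: "v \<cdot>\<^bsub>C\<^esub> \<theta> ?d = \<mu> c" .
    have vm: "v \<cdot>\<^bsub>C\<^esub> \<mu> ?d \<in> hom C (\<I> ?d) (omap T c)" by (rule C.comp_hom[OF mu'[OF d] v])
    have "(v \<cdot>\<^bsub>C\<^esub> \<mu> ?d) \<cdot>\<^bsub>C\<^esub> \<eta> ?d = \<mu> c \<cdot>\<^bsub>C\<^esub> Idt C ?d"
      using C.comp_assoc[OF eta[OF d] mu'[OF d] v] fac[OF d] vth C.comp_idt[OF mu'[OF c]] by simp
    from orth[OF etaE[OF d] muM[OF c] eta[OF d] mu'[OF c] C.idt_hom[OF d] vm this]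
    obtain r where r: "r \<in> hom C (\<I> ?d) ?d" "r \<cdot>\<^bsub>C\<^esub> \<eta> ?d = Idt C ?d" by blast
    note ri = inv[OF d r]
    have "orth C e (\<theta> ?d)" if e: "e \<in> \<E>" for e
      unfolding orth_def
    proof (intro ballI impI)
      fix u w assume "u \<in> hom C (Dom C e) (Dom C (\<theta> ?d))" "w \<in> hom C (Cod C e) (Cod C (\<theta> ?d))"
        and sq: "w \<cdot>\<^bsub>C\<^esub> e = \<theta> ?d \<cdot>\<^bsub>C\<^esub> u"
      then have u: "u \<in> hom C (Dom C e) ?d" and w: "w \<in> hom C (Cod C e) (omap T ?d)"
        using thh[OF d] by (auto simp: hom_def)
      have eA: "e \<in> hom C (Dom C e) (Cod C e)"
        using e pre unfolding prefactorization_system_def hom_def by blast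
      have eu: "\<eta> ?d \<cdot>\<^bsub>C\<^esub> u \<in> hom C (Dom C e) (\<I> ?d)" by (rule C.comp_hom[OF u eta[OF d]])
      have "w \<cdot>\<^bsub>C\<^esub> e = \<mu> ?d \<cdot>\<^bsub>C\<^esub> (\<eta> ?d \<cdot>\<^bsub>C\<^esub> u)"
        using sq fac[OF d] C.comp_assoc[OF u eta[OF d] mu'[OF d]] by simp
      note ex1 = orth[OF e muM[OF d] eA mu'[OF d] eu w this]
      then obtain k where k: "k \<in> hom C (Cod C e) (\<I> ?d)" "k \<cdot>\<^bsub>C\<^esub> e = \<eta> ?d \<cdot>\<^bsub>C\<^esub> u"
        "\<mu> ?d \<cdot>\<^bsub>C\<^esub> k = w" by blast
      have D: "Dom C (\<theta> ?d) = ?d" using thh[OF d] by (simp add: hom_def)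
      show "\<exists>!k. k \<in> hom C (Cod C e) (Dom C (\<theta> ?d)) \<and> k \<cdot>\<^bsub>C\<^esub> e = u \<and> \<theta> ?d \<cdot>\<^bsub>C\<^esub> k = w"
        unfolding D
      proof (rule ex1I[of _ "r \<cdot>\<^bsub>C\<^esub> k"], intro conjI)
        show rk: "r \<cdot>\<^bsub>C\<^esub> k \<in> hom C (Cod C e) ?d" by (rule C.comp_hom[OF k(1) r(1)])
        show "(r \<cdot>\<^bsub>C\<^esub> k) \<cdot>\<^bsub>C\<^esub> e = u"
          using C.comp_assoc[OF eA k(1) r(1)] C.comp_assoc[OF u eta[OF d] r(1)] k(2) r(2)
            C.idt_comp[OF u] by simp
        show "\<theta> ?d \<cdot>\<^bsub>C\<^esub> (r \<cdot>\<^bsub>C\<^esub> k) = w"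
          using C.comp_assoc[OF rk eta[OF d] mu'[OF d]] C.comp_assoc[OF k(1) r(1) eta[OF d]] ri
            C.idt_comp[OF k(1)] k(3) fac[OF d] by simp
      next
        fix l assume l: "l \<in> hom C (Cod C e) ?d \<and> l \<cdot>\<^bsub>C\<^esub> e = u \<and> \<theta> ?d \<cdot>\<^bsub>C\<^esub> l = w"
        then have l1: "l \<in> hom C (Cod C e) ?d" by blast
        have "\<eta> ?d \<cdot>\<^bsub>C\<^esub> l \<in> hom C (Cod C e) (\<I> ?d)" by (rule C.comp_hom[OF l1 eta[OF d]])
        moreover have "(\<eta> ?d \<cdot>\<^bsub>C\<^esub> l) \<cdot>\<^bsub>C\<^esub> e = \<eta> ?d \<cdot>\<^bsub>C\<^esub> u"
          using C.comp_assoc[OF eA l1 eta[OF d]] l by simp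
        moreover have "\<mu> ?d \<cdot>\<^bsub>C\<^esub> (\<eta> ?d \<cdot>\<^bsub>C\<^esub> l) = w"
          using C.comp_assoc[OF l1 eta[OF d] mu'[OF d]] l fac[OF d] by simp
        ultimately have "\<eta> ?d \<cdot>\<^bsub>C\<^esub> l = k" using ex1 k by blast
        then show "l = r \<cdot>\<^bsub>C\<^esub> k"
          using C.comp_assoc[OF l1 eta[OF d] r(1)] r(2) C.idt_comp[OF l1] by simp
      qed
    qed
    then show ?thesis using pre thh[OF d] unfolding prefactorization_system_def hom_def by blast
  qed
  have BO: "a \<in> Obj B \<longleftrightarrow> a \<in> Obj C \<and> \<theta> a \<in> \<M>" for a
    by (simp add: B_def M_subcat_def full_subcat_def)
  have Bs: "Comp B = Comp C" "Idt B = Idt C" "Dom B = Dom C" "Cod B = Cod C"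
    by (simp_all add: B_def M_subcat_def full_subcat_def)
  have Bh: "f \<in> hom B a b \<longleftrightarrow> f \<in> hom C a b \<and> \<theta> a \<in> \<M> \<and> \<theta> b \<in> \<M>" for f a b
    by (auto simp: B_def M_subcat_def full_subcat_def hom_def)
  have catB: "category B"
  proof
    fix f assume "f \<in> Arr B"
    then show "Dom B f \<in> Obj B" "Cod B f \<in> Obj B"
      using C.dom_Obj C.cod_Obj by (auto simp: B_def M_subcat_def full_subcat_def)
  qed (auto simp: Bh Bs BO intro: C.idt_hom C.comp_hom C.comp_idt C.idt_comp C.comp_assoc)
  have funI: "is_functor C B I"
    unfolding is_functor_def Bh Bs BO Io
  proof (intro conjI ballI allI)
    fix a assume a: "a \<in> Obj C"
    show "\<I> a \<in> Obj C" "\<theta> (\<I> a) \<in> \<M>" using IO IM a by auto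
    have i: "Idt C a \<in> hom C a a" by (rule C.idt_hom[OF a])
    show "amap I (Idt C a) = Idt C (\<I> a)"
      by (rule epiD[OF a If(1)[OF i] C.idt_hom[OF IO[OF a]]])
        (simp add: If(2)[OF i] C.comp_idt[OF eta[OF a]] C.idt_comp[OF eta[OF a]])
  next
    fix a b f assume f: "f \<in> hom C a b"
    show "amap I f \<in> hom C (\<I> a) (\<I> b)" "\<theta> (\<I> a) \<in> \<M>" "\<theta> (\<I> b) \<in> \<M>"
      using If(1)[OF f] IM homO[OF f] by auto
    fix c g assume g: "g \<in> hom C b c"
    have gf: "g \<cdot>\<^bsub>C\<^esub> f \<in> hom C a c" by (rule C.comp_hom[OF f g])
    note a = homO(1)[OF f] and b = homO(2)[OF f] and c = homO(2)[OF g]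
    show "amap I (g \<cdot>\<^bsub>C\<^esub> f) = amap I g \<cdot>\<^bsub>C\<^esub> amap I f"
      by (rule epiD[OF a If(1)[OF gf] C.comp_hom[OF If(1)[OF f] If(1)[OF g]]])
        (simp add: If(2)[OF gf] C.comp_assoc[OF eta[OF a] If(1)[OF f] If(1)[OF g]] If(2)[OF f]
          C.comp_assoc[OF f eta[OF b] If(1)[OF g], symmetric] If(2)[OF g] C.comp_assoc[OF f g eta[OF c]])
  qed
  define \<delta> where "\<delta> m = (SOME r. r \<in> hom C (\<I> m) m \<and> r \<cdot>\<^bsub>C\<^esub> \<eta> m = Idt C m)" for m
  have d: "\<delta> m \<in> hom C (\<I> m) m" "\<delta> m \<cdot>\<^bsub>C\<^esub> \<eta> m = Idt C m" if "m \<in> Obj C" "\<theta> m \<in> \<M>" for m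
    using someI_ex[OF ret[OF that]] by (simp_all add: \<delta>_def)
  have dn: "\<delta> b \<cdot>\<^bsub>C\<^esub> amap I f = f \<cdot>\<^bsub>C\<^esub> \<delta> a"
    if f: "f \<in> hom C a b" and M: "\<theta> a \<in> \<M>" "\<theta> b \<in> \<M>" for a b f
  proof -
    note a = homO(1)[OF f] and b = homO(2)[OF f]
    note da = d[OF a M(1)] and db = d[OF b M(2)]
    show ?thesis
      by (rule epiD[OF a C.comp_hom[OF If(1)[OF f] db(1)] C.comp_hom[OF da(1) f]])
        (simp add: C.comp_assoc[OF eta[OF a] If(1)[OF f] db(1)] If(2)[OF f]
          C.comp_assoc[OF f eta[OF b] db(1), symmetric] db(2) da(2) C.idt_comp[OF f]
          C.comp_assoc[OF eta[OF a] da(1) f] C.comp_idt[OF f])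
  qed
  have Ie: "amap I (\<eta> c) = \<eta> (\<I> c)" if c: "c \<in> Obj C" for c
    by (rule epiD[OF c If(1)[OF eta[OF c]] eta[OF IO[OF c]] If(2)[OF eta[OF c]]])
  have "is_adjunction C B I id_functor \<eta>"
    unfolding is_adjunction_def
  proof (intro conjI exI[of _ \<delta>] ballI)
    show "is_functor B C id_functor"
      by (auto simp: is_functor_def Bh BO Bs id_functor_def)
    show "is_nat_trans C C id_functor (id_functor \<circ>\<^sub>F I) \<eta>"
      using eta If(2) by (auto simp: is_nat_trans_def id_functor_def functor_comp_def Io)
    show "is_nat_trans B B (I \<circ>\<^sub>F id_functor) id_functor \<delta>"
      using d dn IM by (auto simp: is_nat_trans_def id_functor_def functor_comp_def Io Bh BO Bs)
    fix a assume a: "a \<in> Obj C"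
    show "\<delta> (omap I a) \<cdot>\<^bsub>B\<^esub> amap I (\<eta> a) = Idt B (omap I a)"
      using d(2)[OF IO[OF a] IM[OF a]] by (simp add: Bs Io Ie[OF a])
  next
    fix x assume "x \<in> Obj B"
    then show "amap id_functor (\<delta> x) \<cdot>\<^bsub>C\<^esub> \<eta> (omap id_functor x) = Idt C (omap id_functor x)"
      using d(2) by (simp add: BO id_functor_def)
  qed (use catB funI C.category_axioms in auto)
  then show ?thesis by (simp add: B_def I_def T_def)
qed

definition inverted_by :: "('o, 'a) cat \<Rightarrow> ('p, 'b) cat \<Rightarrow> ('o, 'a, 'p, 'b) functor_data
    \<Rightarrow> 'a set" where
  "inverted_by C B I = {f \<in> Arr C. is_iso B (amap I f)}"

(* For a reflector I of C onto a full subcategory B with unit \<eta>. *)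
definition stable_units :: "('o, 'a) cat \<Rightarrow> ('o, 'a) cat \<Rightarrow> ('o, 'a, 'o, 'a) functor_data
    \<Rightarrow> ('o \<Rightarrow> 'a) \<Rightarrow> bool" where
  "stable_units C B I \<eta> \<longleftrightarrow>
    (\<forall>c \<in> Obj C. \<eta> c \<in> largest_pullback_closed C (inverted_by C B I))"

end

theory Submission
  imports Defs
begin

text \<open>
  The two halves rest on one observation: the left adjoint \<open>F\<close> inverts every \<open>\<eta> c\<close>. The
  transpose of \<open>\<mu> c\<close> under the adjunction is a retraction of \<open>F \<eta>\<^sub>c\<close>, because the transpose of
  \<open>\<theta> c = \<mu> c \<cdot> \<eta> c\<close> is the identity; and \<open>F \<eta>\<^sub>c\<close> is an epimorphism, because left adjoints
  preserve epimorphisms. A split monomorphism that is epi is invertible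
  (\<open>left_adjoint_inverts_eta\<close>).

  Suppose first that the units are stable, and let \<open>p\<close> be a pullback of \<open>\<eta> c\<close>. Then \<open>I p\<close> is
  invertible, and applying \<open>F\<close> to the naturality square of \<open>\<eta>\<close> at \<open>p\<close> shows that \<open>F p\<close>, hence
  \<open>GF p\<close>, is invertible (\<open>GF_inverts_inverted_by_I\<close>). So \<open>GF\<close> sends the pullback square to a
  commutative square with two parallel invertible sides, and such a square is a pullback.

  Conversely, a morphism lies in the largest pullback-closed part of a class exactly when all its
  pullbacks lie in the class (\<open>mem_largest_pullback_closed_iff\<close>, by pasting of pullbacks). It is
  therefore enough to see that \<open>I\<close> inverts each pullback \<open>p\<close> of \<open>\<eta> c\<close>. Condition (b) puts \<open>p\<close>
  in \<open>\<E>\<close>, and condition (a) exhibits \<open>GF p\<close> as a pullback of the invertible \<open>GF \<eta>\<^sub>c\<close>, so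
  \<open>GF p\<close> is invertible. These two facts suffice (\<open>I_inverts_E_if_GF_inverts\<close>): for
  \<open>p : P \<rightarrow> A\<close>, the composite \<open>\<eta> A \<cdot> p\<close> is in \<open>\<E>\<close>, and with \<open>t\<close> the inverse of \<open>GF p\<close> the
  square \<open>(t \<cdot> \<mu> A) \<cdot> (\<eta> A \<cdot> p) = \<mu> P \<cdot> \<eta> P\<close> has a diagonal \<open>I A \<rightarrow> I P\<close>, which is the inverse
  of \<open>I p\<close>.
\<close>

section \<open>Isomorphisms and epimorphisms\<close>

context category
begin

lemma hom_Obj:
  assumes "f \<in> hom C a b"
  shows "a \<in> Obj C" "b \<in> Obj C"
  using assms dom_Obj cod_Obj by (auto simp: hom_def)

lemma is_isoI:
  assumes "f \<in> hom C a b" "g \<in> hom C b a" "g \<cdot> f = Idt C a" "f \<cdot> g = Idt C b"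
  shows "is_iso C f"
  using assms by (auto simp: is_iso_def hom_def)

lemma is_isoE:
  assumes "is_iso C f" "f \<in> hom C a b"
  obtains g where "g \<in> hom C b a" "g \<cdot> f = Idt C a" "f \<cdot> g = Idt C b"
  using assms by (auto simp: is_iso_def hom_def)

lemma cancel_retraction:
  assumes "r \<cdot> f = Idt C b" "f \<in> hom C b c" "r \<in> hom C c b" "h \<in> hom C a b"
  shows "r \<cdot> (f \<cdot> h) = h"
  using assms comp_assoc[of h a b f c r b] idt_comp by simp

lemma is_iso_comp:
  assumes "is_iso C f" "is_iso C g" and f: "f \<in> hom C a b" and g: "g \<in> hom C b c"
  shows "is_iso C (g \<cdot> f)"
proof -
  obtain f' where f': "f' \<in> hom C b a" "f' \<cdot> f = Idt C a" "f \<cdot> f' = Idt C b"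
    using is_isoE assms(1) f by blast
  obtain g' where g': "g' \<in> hom C c b" "g' \<cdot> g = Idt C b" "g \<cdot> g' = Idt C c"
    using is_isoE assms(2) g by blast
  show ?thesis
  proof (rule is_isoI)
    show "g \<cdot> f \<in> hom C a c" "f' \<cdot> g' \<in> hom C c a"
      using comp_hom f g f'(1) g'(1) by blast+
    show "(f' \<cdot> g') \<cdot> (g \<cdot> f) = Idt C a"
      using comp_assoc[OF comp_hom[OF f g] g'(1) f'(1)] cancel_retraction[OF g'(2) g g'(1) f] f'(2)
      by simp
    show "(g \<cdot> f) \<cdot> (f' \<cdot> g') = Idt C c"
      using comp_assoc[OF comp_hom[OF g'(1) f'(1)] f g] cancel_retraction[OF f'(3) f'(1) f g'(1)]
        g'(3) by simp
  qed
qed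

lemma is_iso_cancel_left:
  assumes "is_iso C g" "is_iso C (g \<cdot> f)" and f: "f \<in> hom C a b" and g: "g \<in> hom C b c"
  shows "is_iso C f"
proof -
  obtain g' where g': "g' \<in> hom C c b" "g' \<cdot> g = Idt C b" "g \<cdot> g' = Idt C c"
    using is_isoE assms(1) g by blast
  have "is_iso C g'" using is_isoI g' g by blast
  then have "is_iso C (g' \<cdot> (g \<cdot> f))" using is_iso_comp assms(2) comp_hom[OF f g] g'(1) by blast
  then show ?thesis using cancel_retraction[OF g'(2) g g'(1) f] by simp
qed

lemma is_epiD:
  assumes "is_epi C e" "e \<in> hom C a b" "g \<in> hom C b c" "h \<in> hom C b c" "g \<cdot> e = h \<cdot> e"
  shows "g = h"
  using assms by (auto simp: is_epi_def hom_def)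

lemma is_iso_if_split_mono_epi:
  assumes f: "f \<in> hom C a b" and r: "r \<in> hom C b a" "r \<cdot> f = Idt C a" and "is_epi C f"
  shows "is_iso C f"
proof (rule is_isoI[OF f r])
  show "f \<cdot> r = Idt C b"
  proof (rule is_epiD[OF \<open>is_epi C f\<close> f])
    show "f \<cdot> r \<in> hom C b b" using comp_hom r(1) f by blast
    show "Idt C b \<in> hom C b b" using idt_hom hom_Obj f by blast
    show "(f \<cdot> r) \<cdot> f = Idt C b \<cdot> f"
      using comp_assoc[OF f r(1) f] r(2) comp_idt[OF f] idt_comp[OF f] by simp
  qed
qed

section \<open>Pullback squares\<close>

lemma is_pullback_hom_iff:
  assumes "p \<in> hom C d a" "q \<in> hom C d b" "f \<in> hom C a c" "g \<in> hom C b c"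
  shows "is_pullback C p q f g \<longleftrightarrow> f \<cdot> p = g \<cdot> q \<and>
    (\<forall>z x y. x \<in> hom C z a \<and> y \<in> hom C z b \<and> f \<cdot> x = g \<cdot> y \<longrightarrow>
      (\<exists>!u. u \<in> hom C z d \<and> p \<cdot> u = x \<and> q \<cdot> u = y))"
proof -
  have "p \<in> Arr C" "q \<in> Arr C" "f \<in> Arr C" "g \<in> Arr C" "Dom C p = d" "Dom C q = d"
    "Cod C p = a" "Dom C f = a" "Cod C q = b" "Dom C g = b" "Cod C f = c" "Cod C g = c"
    using assms by (simp_all add: hom_def)
  then show ?thesis unfolding is_pullback_def by (simp add: Ball_def) blast
qed

lemma is_pullbackE:
  assumes "is_pullback C p q f g"
  obtains a b c d where "p \<in> hom C d a" "q \<in> hom C d b" "f \<in> hom C a c" "g \<in> hom C b c"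
    "f \<cdot> p = g \<cdot> q"
  using assms unfolding is_pullback_def hom_def by auto

lemma is_pullback_hom: "is_pullback C p q f g \<Longrightarrow> p \<in> hom C (Dom C p) (Cod C p)"
  by (simp add: is_pullback_def hom_def)

lemma is_pullback_if_parallel_isos:
  assumes p: "p \<in> hom C d a" and q: "q \<in> hom C d b" and f: "f \<in> hom C a c" and g: "g \<in> hom C b c"
    and sq: "f \<cdot> p = g \<cdot> q" and "is_iso C p" "is_iso C g"
  shows "is_pullback C p q f g"
  unfolding is_pullback_hom_iff[OF p q f g]
proof (intro conjI allI impI, fact sq, elim conjE)
  obtain p' where p': "p' \<in> hom C a d" "p' \<cdot> p = Idt C d" "p \<cdot> p' = Idt C a"
    using is_isoE \<open>is_iso C p\<close> p by blast
  obtain g' where g': "g' \<in> hom C c b" "g' \<cdot> g = Idt C b" "g \<cdot> g' = Idt C c"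
    using is_isoE \<open>is_iso C g\<close> g by blast
  fix z x y assume x: "x \<in> hom C z a" and y: "y \<in> hom C z b" and xy: "f \<cdot> x = g \<cdot> y"
  show "\<exists>!u. u \<in> hom C z d \<and> p \<cdot> u = x \<and> q \<cdot> u = y"
  proof (rule ex1I[of _ "p' \<cdot> x"], intro conjI)
    show u: "p' \<cdot> x \<in> hom C z d" using comp_hom[OF x p'(1)] .
    show pu: "p \<cdot> (p' \<cdot> x) = x" using cancel_retraction[OF p'(3) p'(1) p x] .
    have qu: "q \<cdot> (p' \<cdot> x) \<in> hom C z b" using comp_hom[OF u q] .
    have "g \<cdot> (q \<cdot> (p' \<cdot> x)) = (f \<cdot> p) \<cdot> (p' \<cdot> x)" using comp_assoc[OF u q g] sq by simp
    also have "\<dots> = g \<cdot> y" using comp_assoc[OF u p f] pu xy by simp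
    finally have "g \<cdot> (q \<cdot> (p' \<cdot> x)) = g \<cdot> y" .
    then have "g' \<cdot> (g \<cdot> (q \<cdot> (p' \<cdot> x))) = g' \<cdot> (g \<cdot> y)" by simp
    then show "q \<cdot> (p' \<cdot> x) = y"
      using cancel_retraction[OF g'(2) g g'(1)] qu y by simp
  next
    fix u assume "u \<in> hom C z d \<and> p \<cdot> u = x \<and> q \<cdot> u = y"
    then show "u = p' \<cdot> x" using cancel_retraction[OF p'(2) p p'(1), of u z] by auto
  qed
qed

text \<open>
  If \<open>g'\<close> inverts \<open>g\<close>, the cone formed by the identity and \<open>g' \<cdot> f\<close> induces a section \<open>s\<close> of
  \<open>p\<close>; uniqueness of mediating morphisms makes \<open>s\<close> an inverse.
\<close>

lemma is_iso_pullback_of_iso: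
  assumes "is_pullback C p q f g" "is_iso C g"
  shows "is_iso C p"
proof -
  obtain a b c d where p: "p \<in> hom C d a" and q: "q \<in> hom C d b" and f: "f \<in> hom C a c"
    and g: "g \<in> hom C b c" and sq: "f \<cdot> p = g \<cdot> q"
    using assms(1) by (rule is_pullbackE)
  note univ = assms(1)[unfolded is_pullback_hom_iff[OF p q f g], THEN conjunct2, rule_format,
    OF conjI, OF _ conjI]
  obtain g' where g': "g' \<in> hom C c b" "g' \<cdot> g = Idt C b" "g \<cdot> g' = Idt C c"
    using is_isoE \<open>is_iso C g\<close> g by blast
  have ia: "Idt C a \<in> hom C a a" and id: "Idt C d \<in> hom C d d" using idt_hom hom_Obj p by blast+
  have g'f: "g' \<cdot> f \<in> hom C a b" using comp_hom[OF f g'(1)] .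
  have "f \<cdot> Idt C a = g \<cdot> (g' \<cdot> f)"
    using cancel_retraction[OF g'(3) g'(1) g f] comp_idt[OF f] by simp
  then obtain s where s: "s \<in> hom C a d" "p \<cdot> s = Idt C a" "q \<cdot> s = g' \<cdot> f"
    using univ[OF ia g'f] by blast
  have sp: "s \<cdot> p \<in> hom C d d" using comp_hom[OF p s(1)] .
  have "p \<cdot> (s \<cdot> p) = p" using cancel_retraction[OF s(2) s(1) p p] .
  moreover have "q \<cdot> (s \<cdot> p) = q"
  proof -
    have "q \<cdot> (s \<cdot> p) = g' \<cdot> (f \<cdot> p)"
      using comp_assoc[OF p s(1) q] s(3) comp_assoc[OF p f g'(1)] by simp
    also have "\<dots> = q" using sq cancel_retraction[OF g'(2) g g'(1) q] by simp
    finally show ?thesis .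
  qed
  \<comment> \<open>both \<open>s \<cdot> p\<close> and the identity are mediating morphisms from the pullback cone to itself\<close>
  ultimately have "s \<cdot> p = Idt C d"
    using univ[OF p q sq] sp id comp_idt[OF p] comp_idt[OF q] by blast
  then show ?thesis using is_isoI p s by blast
qed

lemma is_pullback_paste:
  assumes "is_pullback C p' q' f' p" "is_pullback C p q f g"
  shows "is_pullback C p' (q \<cdot> q') (f \<cdot> f') g"
proof -
  obtain a b c d where p: "p \<in> hom C d a" and q: "q \<in> hom C d b" and f: "f \<in> hom C a c"
    and g: "g \<in> hom C b c" and sq: "f \<cdot> p = g \<cdot> q"
    using assms(2) by (rule is_pullbackE)
  obtain a' d' where p': "p' \<in> hom C d' a'" and q': "q' \<in> hom C d' d" and f': "f' \<in> hom C a' a"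
    and sq': "f' \<cdot> p' = p \<cdot> q'"
    using assms(1) p by (elim is_pullbackE) (auto simp: hom_def)
  note univ = assms(2)[unfolded is_pullback_hom_iff[OF p q f g], THEN conjunct2, rule_format,
    OF conjI, OF _ conjI]
  note univ' = assms(1)[unfolded is_pullback_hom_iff[OF p' q' f' p], THEN conjunct2, rule_format,
    OF conjI, OF _ conjI]
  have qq': "q \<cdot> q' \<in> hom C d' b" and ff': "f \<cdot> f' \<in> hom C a' c"
    using comp_hom q q' f f' by blast+
  show ?thesis
    unfolding is_pullback_hom_iff[OF p' qq' ff' g]
  proof (intro conjI allI impI, goal_cases)
    case 1
    show ?case
      using comp_assoc[OF p' f' f] sq' comp_assoc[OF q' p f] sq comp_assoc[OF q' q g] by simp
  next
    case (2 z x y)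
    then have x: "x \<in> hom C z a'" and y: "y \<in> hom C z b" and xy: "(f \<cdot> f') \<cdot> x = g \<cdot> y" by auto
    have f'x: "f' \<cdot> x \<in> hom C z a" using comp_hom[OF x f'] .
    have "f \<cdot> (f' \<cdot> x) = g \<cdot> y" using comp_assoc[OF x f' f] xy by simp
    from univ[OF f'x y this] obtain v where v: "v \<in> hom C z d" "p \<cdot> v = f' \<cdot> x" "q \<cdot> v = y"
      and v_unique: "\<And>w. \<lbrakk>w \<in> hom C z d; p \<cdot> w = f' \<cdot> x; q \<cdot> w = y\<rbrakk> \<Longrightarrow> w = v" by blast
    note ex1 = univ'[OF x v(1) v(2)[symmetric]]
    then obtain u where u: "u \<in> hom C z d'" "p' \<cdot> u = x" "q' \<cdot> u = v" by blast
    show ?case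
    proof (rule ex1I[of _ u], intro conjI)
      show "(q \<cdot> q') \<cdot> u = y" using comp_assoc[OF u(1) q' q] u(3) v(3) by simp
    next
      fix w assume "w \<in> hom C z d' \<and> p' \<cdot> w = x \<and> (q \<cdot> q') \<cdot> w = y"
      then have w: "w \<in> hom C z d'" "p' \<cdot> w = x" "(q \<cdot> q') \<cdot> w = y" by auto
      have "q' \<cdot> w = v"
      proof (rule v_unique)
        show "q' \<cdot> w \<in> hom C z d" using comp_hom[OF w(1) q'] .
        show "p \<cdot> (q' \<cdot> w) = f' \<cdot> x"
          using comp_assoc[OF w(1) q' p] comp_assoc[OF w(1) p' f'] sq' w(2) by simp
        show "q \<cdot> (q' \<cdot> w) = y" using comp_assoc[OF w(1) q' q] w(3) by simp
      qed
      then show "w = u" using ex1 u w by blast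
    qed (use u in auto)
  qed
qed

lemma is_pullback_along_identity:
  assumes "f \<in> hom C a b"
  shows "is_pullback C f (Idt C a) (Idt C b) f"
proof -
  have "Idt C a \<in> hom C a a" "Idt C b \<in> hom C b b" using idt_hom hom_Obj[OF assms] by auto
  then show ?thesis
    using assms by (subst is_pullback_hom_iff[where a=b and b=a and c=b and d=a])
      (auto simp: comp_idt idt_comp)
qed

text \<open>
  By pasting, the pullbacks of a fixed morphism form a pullback-closed class. This turns membership
  in the union of all closed subclasses into a test on single squares.
\<close>

lemma mem_largest_pullback_closed_iff:
  assumes f: "f \<in> hom C a b"
  shows "f \<in> largest_pullback_closed C \<S> \<longleftrightarrow> (\<forall>p q g. is_pullback C p q g f \<longrightarrow> p \<in> \<S>)"
proof
  assume "f \<in> largest_pullback_closed C \<S>"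
  then show "\<forall>p q g. is_pullback C p q g f \<longrightarrow> p \<in> \<S>"
    using largest_pullback_closed_props(1,2)[of C \<S>] unfolding pullback_closed_def by blast
next
  assume *: "\<forall>p q g. is_pullback C p q g f \<longrightarrow> p \<in> \<S>"
  let ?T = "{p. \<exists>q g. is_pullback C p q g f}"
  have "pullback_closed C ?T" unfolding pullback_closed_def using is_pullback_paste by blast
  with * have "?T \<subseteq> largest_pullback_closed C \<S>"
    by (intro largest_pullback_closed_props(3)) auto
  then show "f \<in> largest_pullback_closed C \<S>" using is_pullback_along_identity[OF f] by blast
qed

section \<open>Orthogonality and adjoints\<close>

lemma orth_iff:
  assumes "e \<in> hom C a b" "m \<in> hom C c d"
  shows "orth C e m \<longleftrightarrow> (\<forall>u \<in> hom C a c. \<forall>v \<in> hom C b d. v \<cdot> e = m \<cdot> u \<longrightarrow>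
    (\<exists>!w. w \<in> hom C b c \<and> w \<cdot> e = u \<and> m \<cdot> w = v))"
  using assms unfolding orth_def hom_def by auto

lemma orth_diagonal:
  assumes "orth C e m" and e: "e \<in> hom C a b" and m: "m \<in> hom C c d"
    and "u \<in> hom C a c" "v \<in> hom C b d" "v \<cdot> e = m \<cdot> u"
  obtains w where "w \<in> hom C b c" "w \<cdot> e = u" "m \<cdot> w = v"
  using assms(1)[unfolded orth_iff[OF e m], rule_format, OF assms(4-6)] that by (elim ex1E conjE)

lemma orth_diagonal_unique:
  assumes "orth C e m" and e: "e \<in> hom C a b" and m: "m \<in> hom C c d"
    and w: "w \<in> hom C b c" and w': "w' \<in> hom C b c"
    and "w \<cdot> e = w' \<cdot> e" "m \<cdot> w = m \<cdot> w'"
  shows "w = w'"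
proof -
  have "(m \<cdot> w) \<cdot> e = m \<cdot> (w \<cdot> e)" using comp_assoc[OF e w m] .
  from assms(1)[unfolded orth_iff[OF e m], rule_format, OF comp_hom[OF e w] comp_hom[OF w m] this]
  obtain k where k: "\<And>l. \<lbrakk>l \<in> hom C b c; l \<cdot> e = w \<cdot> e; m \<cdot> l = m \<cdot> w\<rbrakk> \<Longrightarrow> l = k" by auto
  have "w = k" by (rule k[OF w refl refl])
  moreover have "w' = k" by (rule k[OF w' assms(6,7)[symmetric]])
  ultimately show ?thesis by simp
qed

text \<open>
  The diagonal for \<open>e' \<cdot> e\<close> is built in two steps: first \<open>w\<close> for the square over \<open>e\<close> with lower
  side \<open>v \<cdot> e'\<close>, then the diagonal \<open>k\<close> for the square over \<open>e'\<close> whose upper side is \<open>w\<close>.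
\<close>

lemma orth_comp:
  assumes "orth C e m" "orth C e' m" and e: "e \<in> hom C a b" and e': "e' \<in> hom C b b'"
    and m: "m \<in> hom C c d"
  shows "orth C (e' \<cdot> e) m"
  unfolding orth_iff[OF comp_hom[OF e e'] m]
proof (intro ballI impI)
  fix u v assume u: "u \<in> hom C a c" and v: "v \<in> hom C b' d" and uv: "v \<cdot> (e' \<cdot> e) = m \<cdot> u"
  have ve': "v \<cdot> e' \<in> hom C b d" using comp_hom[OF e' v] .
  have "(v \<cdot> e') \<cdot> e = m \<cdot> u" using comp_assoc[OF e e' v] uv by simp
  from orth_diagonal[OF assms(1) e m u ve' this]
  obtain w where w: "w \<in> hom C b c" "w \<cdot> e = u" "m \<cdot> w = v \<cdot> e'" .
  from orth_diagonal[OF assms(2) e' m w(1) v w(3)[symmetric]]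
  obtain k where k: "k \<in> hom C b' c" "k \<cdot> e' = w" "m \<cdot> k = v" .
  show "\<exists>!k. k \<in> hom C b' c \<and> k \<cdot> (e' \<cdot> e) = u \<and> m \<cdot> k = v"
  proof (rule ex1I[of _ k], intro conjI)
    show "k \<cdot> (e' \<cdot> e) = u" using comp_assoc[OF e e' k(1)] k(2) w(2) by simp
  next
    fix l assume "l \<in> hom C b' c \<and> l \<cdot> (e' \<cdot> e) = u \<and> m \<cdot> l = v"
    then have l: "l \<in> hom C b' c" "l \<cdot> (e' \<cdot> e) = u" "m \<cdot> l = v" by auto
    have "l \<cdot> e' = w"
      using orth_diagonal_unique[OF assms(1) e m comp_hom[OF e' l(1)] w(1)]
        comp_assoc[OF e e' l(1)] comp_assoc[OF e' l(1) m] l(2,3) w(2,3) by simp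
    then show "l = k"
      using orth_diagonal_unique[OF assms(2) e' m l(1) k(1)] k(2,3) l(3) by simp
  qed (use k in auto)
qed

end

lemma functor_preserves_iso:
  assumes "category C" "category D" "is_functor C D F" "is_iso C f"
  shows "is_iso D (amap F f)"
proof -
  interpret C: category C by fact
  interpret D: category D by fact
  have f: "f \<in> hom C (Dom C f) (Cod C f)" using assms(4) by (simp add: is_iso_def hom_def)
  obtain g where g: "g \<in> hom C (Cod C f) (Dom C f)" "g \<cdot>\<^bsub>C\<^esub> f = Idt C (Dom C f)"
    "f \<cdot>\<^bsub>C\<^esub> g = Idt C (Cod C f)"
    using C.is_isoE[OF assms(4) f] .
  have "amap F g \<cdot>\<^bsub>D\<^esub> amap F f = Idt D (omap F (Dom C f))"
    "amap F f \<cdot>\<^bsub>D\<^esub> amap F g = Idt D (omap F (Cod C f))"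
    using assms(3) f g C.hom_Obj[OF f] unfolding is_functor_def by metis+
  moreover have "amap F f \<in> hom D (omap F (Dom C f)) (omap F (Cod C f))"
    "amap F g \<in> hom D (omap F (Cod C f)) (omap F (Dom C f))"
    using assms(3) f g(1) unfolding is_functor_def by blast+
  ultimately show ?thesis using D.is_isoI by blast
qed

locale adjunction =
  fixes C :: "('o, 'a) cat" (structure) and X :: "('p, 'b) cat"
    and F :: "('o, 'a, 'p, 'b) functor_data" and G :: "('p, 'b, 'o, 'a) functor_data"
    and \<theta> :: "'o \<Rightarrow> 'a"
  assumes adj: "is_adjunction C X F G \<theta>"
begin

sublocale C: category C using adj by (simp add: is_adjunction_def)
sublocale X: category X using adj by (simp add: is_adjunction_def)

lemma functor_F: "is_functor C X F" and functor_G: "is_functor X C G"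
  using adj by (simp_all add: is_adjunction_def)

lemma F_hom: "f \<in> hom C a b \<Longrightarrow> amap F f \<in> hom X (omap F a) (omap F b)"
  and F_comp: "\<lbrakk>f \<in> hom C a b; g \<in> hom C b c\<rbrakk> \<Longrightarrow> amap F (g \<cdot> f) = amap F g \<cdot>\<^bsub>X\<^esub> amap F f"
  and G_hom: "h \<in> hom X x y \<Longrightarrow> amap G h \<in> hom C (omap G x) (omap G y)"
  and G_comp: "\<lbrakk>h \<in> hom X x y; k \<in> hom X y z\<rbrakk> \<Longrightarrow> amap G (k \<cdot>\<^bsub>X\<^esub> h) = amap G k \<cdot> amap G h"
  and F_Obj: "a \<in> Obj C \<Longrightarrow> omap F a \<in> Obj X"
  using functor_F functor_G unfolding is_functor_def by blast+

lemma T_omap: "omap (G \<circ>\<^sub>F F) a = omap G (omap F a)"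
  and T_amap: "amap (G \<circ>\<^sub>F F) f = amap G (amap F f)"
  by (simp_all add: functor_comp_def)

lemma T_hom: "f \<in> hom C a b \<Longrightarrow> amap (G \<circ>\<^sub>F F) f \<in> hom C (omap G (omap F a)) (omap G (omap F b))"
  using G_hom[OF F_hom] by (simp add: T_amap)

lemma unit_hom: "a \<in> Obj C \<Longrightarrow> \<theta> a \<in> hom C a (omap G (omap F a))"
  and unit_natural: "f \<in> hom C a b \<Longrightarrow> \<theta> b \<cdot> f = amap G (amap F f) \<cdot> \<theta> a"
  using adj by (auto simp: is_adjunction_def is_nat_trans_def id_functor_def functor_comp_def)

definition \<epsilon> :: "'p \<Rightarrow> 'b" where
  "\<epsilon> = (SOME \<epsilon>. is_nat_trans X X (F \<circ>\<^sub>F G) id_functor \<epsilon> \<and>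
    (\<forall>a \<in> Obj C. \<epsilon> (omap F a) \<cdot>\<^bsub>X\<^esub> amap F (\<theta> a) = Idt X (omap F a)))"

lemma counit_hom: "x \<in> Obj X \<Longrightarrow> \<epsilon> x \<in> hom X (omap F (omap G x)) x"
  and counit_natural: "h \<in> hom X x y \<Longrightarrow> \<epsilon> y \<cdot>\<^bsub>X\<^esub> amap F (amap G h) = h \<cdot>\<^bsub>X\<^esub> \<epsilon> x"
  and counit_triangle: "a \<in> Obj C \<Longrightarrow> \<epsilon> (omap F a) \<cdot>\<^bsub>X\<^esub> amap F (\<theta> a) = Idt X (omap F a)"
proof -
  have "\<exists>\<epsilon>. is_nat_trans X X (F \<circ>\<^sub>F G) id_functor \<epsilon> \<and>
    (\<forall>a \<in> Obj C. \<epsilon> (omap F a) \<cdot>\<^bsub>X\<^esub> amap F (\<theta> a) = Idt X (omap F a))"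
    using adj unfolding is_adjunction_def by blast
  from someI_ex[OF this, folded \<epsilon>_def]
  have "is_nat_trans X X (F \<circ>\<^sub>F G) id_functor \<epsilon>"
    and tri: "\<forall>a \<in> Obj C. \<epsilon> (omap F a) \<cdot>\<^bsub>X\<^esub> amap F (\<theta> a) = Idt X (omap F a)" by blast+
  then show "x \<in> Obj X \<Longrightarrow> \<epsilon> x \<in> hom X (omap F (omap G x)) x"
    "h \<in> hom X x y \<Longrightarrow> \<epsilon> y \<cdot>\<^bsub>X\<^esub> amap F (amap G h) = h \<cdot>\<^bsub>X\<^esub> \<epsilon> x"
    by (simp_all add: is_nat_trans_def id_functor_def functor_comp_def)
  show "a \<in> Obj C \<Longrightarrow> \<epsilon> (omap F a) \<cdot>\<^bsub>X\<^esub> amap F (\<theta> a) = Idt X (omap F a)" using tri by blast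
qed

text \<open>The transpose \<open>G h \<cdot> \<theta> a\<close> determines \<open>h\<close>, because \<open>\<epsilon> x \<cdot> F (G h \<cdot> \<theta> a) = h\<close>.\<close>

lemma transpose_inject:
  assumes h: "h \<in> hom X (omap F a) x" and k: "k \<in> hom X (omap F a) x" and a: "a \<in> Obj C"
    and eq: "amap G h \<cdot> \<theta> a = amap G k \<cdot> \<theta> a"
  shows "h = k"
proof -
  have recover: "\<epsilon> x \<cdot>\<^bsub>X\<^esub> amap F (amap G l \<cdot> \<theta> a) = l" if l: "l \<in> hom X (omap F a) x" for l
  proof -
    note Fth = F_hom[OF unit_hom[OF a]] and FGl = F_hom[OF G_hom[OF l]]
    have "\<epsilon> x \<cdot>\<^bsub>X\<^esub> amap F (amap G l \<cdot> \<theta> a) = (\<epsilon> x \<cdot>\<^bsub>X\<^esub> amap F (amap G l)) \<cdot>\<^bsub>X\<^esub> amap F (\<theta> a)"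
      using F_comp[OF unit_hom[OF a] G_hom[OF l]] X.comp_assoc[OF Fth FGl counit_hom] X.hom_Obj[OF l]
      by simp
    also have "\<dots> = l \<cdot>\<^bsub>X\<^esub> (\<epsilon> (omap F a) \<cdot>\<^bsub>X\<^esub> amap F (\<theta> a))"
      using counit_natural[OF l] X.comp_assoc[OF Fth counit_hom[OF F_Obj[OF a]] l] by simp
    also have "\<dots> = l" using counit_triangle[OF a] X.comp_idt[OF l] by simp
    finally show ?thesis .
  qed
  have "h = \<epsilon> x \<cdot>\<^bsub>X\<^esub> amap F (amap G h \<cdot> \<theta> a)" by (rule recover[OF h, symmetric])
  also have "\<dots> = k" unfolding eq by (rule recover[OF k])
  finally show ?thesis .
qed

text \<open>
  Transposition is natural in \<open>a\<close>, so it turns precomposition with \<open>F e\<close> into precomposition with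
  \<open>e\<close>, which can be cancelled.
\<close>

lemma left_adjoint_preserves_epi:
  assumes e: "e \<in> hom C a b" and "is_epi C e"
  shows "is_epi X (amap F e)"
proof -
  note Fe = F_hom[OF e] and a = C.hom_Obj(1)[OF e] and b = C.hom_Obj(2)[OF e]
  have "h = k" if h: "h \<in> hom X (omap F b) x" and k: "k \<in> hom X (omap F b) x"
    and hk: "h \<cdot>\<^bsub>X\<^esub> amap F e = k \<cdot>\<^bsub>X\<^esub> amap F e" for h k x
  proof (rule transpose_inject[OF h k b], rule C.is_epiD[OF \<open>is_epi C e\<close> e])
    show "amap G h \<cdot> \<theta> b \<in> hom C b (omap G x)" "amap G k \<cdot> \<theta> b \<in> hom C b (omap G x)"
      using C.comp_hom[OF unit_hom[OF b]] G_hom h k by auto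
    have "(amap G l \<cdot> \<theta> b) \<cdot> e = amap G (l \<cdot>\<^bsub>X\<^esub> amap F e) \<cdot> \<theta> a"
      if l: "l \<in> hom X (omap F b) x" for l
      using C.comp_assoc[OF e unit_hom[OF b] G_hom[OF l]] unit_natural[OF e] G_comp[OF Fe l]
        C.comp_assoc[OF unit_hom[OF a] G_hom[OF Fe] G_hom[OF l]] by simp
    then show "(amap G h \<cdot> \<theta> b) \<cdot> e = (amap G k \<cdot> \<theta> b) \<cdot> e" using h k hk by simp
  qed
  then show ?thesis using Fe by (auto simp: is_epi_def hom_def)
qed

end

section \<open>The reflection obtained by factorizing the unit\<close>

locale unit_factorization = adjunction C X F G \<theta>
  for C :: "('o, 'a) cat" (structure) and X :: "('p, 'b) cat"
    and F :: "('o, 'a, 'p, 'b) functor_data" and G :: "('p, 'b, 'o, 'a) functor_data"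
    and \<theta> :: "'o \<Rightarrow> 'a" +
  fixes \<I> :: "'o \<Rightarrow> 'o" and \<eta> \<mu> :: "'o \<Rightarrow> 'a" and \<E> \<M> :: "'a set"
  assumes pre: "prefactorization_system C \<E> \<M>"
    and eta: "\<And>c. c \<in> Obj C \<Longrightarrow> \<eta> c \<in> hom C c (\<I> c)"
    and mu: "\<And>c. c \<in> Obj C \<Longrightarrow> \<mu> c \<in> hom C (\<I> c) (omap (G \<circ>\<^sub>F F) c)"
    and fac: "\<And>c. c \<in> Obj C \<Longrightarrow> \<theta> c = \<mu> c \<cdot> \<eta> c"
    and eta_E: "\<And>c. c \<in> Obj C \<Longrightarrow> \<eta> c \<in> \<E>"
    and mu_M: "\<And>c. c \<in> Obj C \<Longrightarrow> \<mu> c \<in> \<M>"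
    and eta_epi: "\<And>c. c \<in> Obj C \<Longrightarrow> is_epi C (\<eta> c)"
begin

abbreviation T where "T \<equiv> G \<circ>\<^sub>F F"
abbreviation I where "I \<equiv> I_functor C T \<I> \<eta> \<mu>"
abbreviation B where "B \<equiv> M_subcat C \<M> \<theta>"

lemma reflection: "is_adjunction C B I id_functor \<eta>"
  using I_functor_reflection[OF adj pre eta mu fac eta_E mu_M eta_epi] .

lemma B_iso_iff:
  assumes "f \<in> Arr B"
  shows "is_iso B f \<longleftrightarrow> is_iso C f"
  using assms by (auto simp: is_iso_def M_subcat_def full_subcat_def hom_def)

lemma I_omap: "omap I c = \<I> c"
  by (simp add: I_functor_def)

lemma I_hom_B: "f \<in> hom C a b \<Longrightarrow> amap I f \<in> hom B (\<I> a) (\<I> b)"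
  using reflection I_omap unfolding is_adjunction_def is_functor_def by metis

lemma I_hom: "f \<in> hom C a b \<Longrightarrow> amap I f \<in> hom C (\<I> a) (\<I> b)"
  using I_hom_B by (auto simp: M_subcat_def full_subcat_def hom_def)

lemma inverted_by_I_iff:
  assumes "f \<in> hom C a b"
  shows "f \<in> inverted_by C B I \<longleftrightarrow> is_iso C (amap I f)"
  using assms B_iso_iff[of "amap I f"] I_hom_B[OF assms] by (auto simp: inverted_by_def hom_def)

lemma eta_natural: "f \<in> hom C a b \<Longrightarrow> amap I f \<cdot> \<eta> a = \<eta> b \<cdot> f"
  using reflection unfolding is_adjunction_def is_nat_trans_def
  by (simp add: id_functor_def functor_comp_def)

lemma mu_hom: "c \<in> Obj C \<Longrightarrow> \<mu> c \<in> hom C (\<I> c) (omap G (omap F c))"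
  using mu by (simp add: T_omap)

text \<open>
  After precomposition with the epimorphism \<open>\<eta> a\<close>, this is naturality of \<open>\<theta> = \<mu> \<cdot> \<eta>\<close> combined
  with that of \<open>\<eta>\<close>.
\<close>

lemma mu_natural:
  assumes f: "f \<in> hom C a b"
  shows "\<mu> b \<cdot> amap I f = amap T f \<cdot> \<mu> a"
proof -
  note a = C.hom_Obj(1)[OF f] and b = C.hom_Obj(2)[OF f]
  note GFf = G_hom[OF F_hom[OF f]]
  show ?thesis
  proof (rule C.is_epiD[OF eta_epi[OF a] eta[OF a]])
    show "\<mu> b \<cdot> amap I f \<in> hom C (\<I> a) (omap G (omap F b))"
      using C.comp_hom[OF I_hom[OF f] mu_hom[OF b]] .
    show "amap T f \<cdot> \<mu> a \<in> hom C (\<I> a) (omap G (omap F b))"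
      using C.comp_hom[OF mu_hom[OF a] GFf] by (simp add: T_amap)
    have "(\<mu> b \<cdot> amap I f) \<cdot> \<eta> a = \<mu> b \<cdot> (\<eta> b \<cdot> f)"
      using C.comp_assoc[OF eta[OF a] I_hom[OF f] mu_hom[OF b]] eta_natural[OF f] by simp
    also have "\<dots> = \<theta> b \<cdot> f" using C.comp_assoc[OF f eta[OF b] mu_hom[OF b]] fac[OF b] by simp
    also have "\<dots> = (amap T f \<cdot> \<mu> a) \<cdot> \<eta> a"
      using unit_natural[OF f] C.comp_assoc[OF eta[OF a] mu_hom[OF a] GFf] fac[OF a]
      by (simp add: T_amap)
    finally show "(\<mu> b \<cdot> amap I f) \<cdot> \<eta> a = (amap T f \<cdot> \<mu> a) \<cdot> \<eta> a" .
  qed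
qed

text \<open>
  The transpose \<open>\<epsilon> \<cdot> F \<mu>\<^sub>c\<close> of \<open>\<mu> c\<close> retracts \<open>F \<eta>\<^sub>c\<close>, by the triangle identity for
  \<open>\<theta> c = \<mu> c \<cdot> \<eta> c\<close>; and \<open>F \<eta>\<^sub>c\<close> is epi.
\<close>

lemma left_adjoint_inverts_eta:
  assumes c: "c \<in> Obj C"
  shows "is_iso X (amap F (\<eta> c))"
proof -
  note Fe = F_hom[OF eta[OF c]] and Fm = F_hom[OF mu_hom[OF c]]
  note ex = counit_hom[OF F_Obj[OF c]]
  have r: "\<epsilon> (omap F c) \<cdot>\<^bsub>X\<^esub> amap F (\<mu> c) \<in> hom X (omap F (\<I> c)) (omap F c)"
    using X.comp_hom[OF Fm ex] .
  have "(\<epsilon> (omap F c) \<cdot>\<^bsub>X\<^esub> amap F (\<mu> c)) \<cdot>\<^bsub>X\<^esub> amap F (\<eta> c) = Idt X (omap F c)"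
    using X.comp_assoc[OF Fe Fm ex] F_comp[OF eta[OF c] mu_hom[OF c]] fac[OF c] counit_triangle[OF c] by simp
  then show ?thesis
    using X.is_iso_if_split_mono_epi[OF Fe r]
      left_adjoint_preserves_epi[OF eta[OF c] eta_epi[OF c]] by simp
qed

lemma GF_inverts_eta:
  assumes "c \<in> Obj C"
  shows "is_iso C (amap T (\<eta> c))"
  using functor_preserves_iso[OF X.category_axioms C.category_axioms functor_G
    left_adjoint_inverts_eta[OF assms]] by (simp add: T_amap)

text \<open>
  Apply \<open>F\<close> to \<open>I f \<cdot> \<eta> a = \<eta> b \<cdot> f\<close>: every morphism in the resulting square other than \<open>F f\<close> is
  invertible.
\<close>

lemma GF_inverts_inverted_by_I:
  assumes f: "f \<in> hom C a b" and "is_iso C (amap I f)"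
  shows "is_iso C (amap T f)"
proof -
  note a = C.hom_Obj(1)[OF f] and b = C.hom_Obj(2)[OF f]
  note Fe = F_hom[OF eta[OF a]] and FI = F_hom[OF I_hom[OF f]]
  have "is_iso X (amap F (amap I f))"
    using functor_preserves_iso[OF C.category_axioms X.category_axioms functor_F assms(2)] .
  then have "is_iso X (amap F (amap I f) \<cdot>\<^bsub>X\<^esub> amap F (\<eta> a))"
    using X.is_iso_comp[OF left_adjoint_inverts_eta[OF a] _ Fe FI] by blast
  also have "amap F (amap I f) \<cdot>\<^bsub>X\<^esub> amap F (\<eta> a) = amap F (\<eta> b) \<cdot>\<^bsub>X\<^esub> amap F f"
    using eta_natural[OF f] F_comp[OF eta[OF a] I_hom[OF f]] F_comp[OF f eta[OF b]] by simp
  finally have "is_iso X (amap F f)"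
    using X.is_iso_cancel_left[OF left_adjoint_inverts_eta[OF b] _ F_hom[OF f] F_hom[OF eta[OF b]]]
    by blast
  then show ?thesis
    using functor_preserves_iso[OF X.category_axioms C.category_axioms functor_G]
    by (simp add: T_amap)
qed

lemma E_orth_M: "\<lbrakk>e \<in> \<E>; m \<in> \<M>\<rbrakk> \<Longrightarrow> orth C e m"
  using pre unfolding prefactorization_system_def by blast

text \<open>
  With \<open>t\<close> the inverse of \<open>GF p\<close>, the square \<open>(t \<cdot> \<mu> b) \<cdot> (\<eta> b \<cdot> p) = \<mu> a \<cdot> \<eta> a\<close> commutes because
  \<open>\<theta> b \<cdot> p = GF p \<cdot> \<theta> a\<close>. Its diagonal is a left inverse of \<open>I p\<close> since \<open>\<eta> a\<close> is epi, and a right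
  inverse since diagonals of \<open>\<eta> b \<cdot> p\<close> against \<open>\<mu> b\<close> are unique.
\<close>

lemma I_inverts_E_if_GF_inverts:
  assumes p: "p \<in> hom C a b" and "p \<in> \<E>" and "is_iso C (amap T p)"
  shows "is_iso C (amap I p)"
proof -
  note a = C.hom_Obj(1)[OF p] and b = C.hom_Obj(2)[OF p]
  note ea = eta[OF a] and eb = eta[OF b] and ma = mu_hom[OF a] and mb = mu_hom[OF b]
    and Ip = I_hom[OF p]
  have Tp: "amap T p \<in> hom C (omap G (omap F a)) (omap G (omap F b))"
    using T_hom[OF p] .
  obtain t where t: "t \<in> hom C (omap G (omap F b)) (omap G (omap F a))"
    "t \<cdot> amap T p = Idt C (omap G (omap F a))" "amap T p \<cdot> t = Idt C (omap G (omap F b))"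
    using C.is_isoE[OF assms(3) Tp] .
  have ep: "\<eta> b \<cdot> p \<in> hom C a (\<I> b)" using C.comp_hom[OF p eb] .
  have orth: "orth C (\<eta> b \<cdot> p) (\<mu> a)" "orth C (\<eta> b \<cdot> p) (\<mu> b)"
    using C.orth_comp[OF _ _ p eb ma] C.orth_comp[OF _ _ p eb mb] E_orth_M \<open>p \<in> \<E>\<close> eta_E mu_M a b
    by auto
  have tm: "t \<cdot> \<mu> b \<in> hom C (\<I> b) (omap G (omap F a))" using C.comp_hom[OF mb t(1)] .
  have "(t \<cdot> \<mu> b) \<cdot> (\<eta> b \<cdot> p) = t \<cdot> (\<theta> b \<cdot> p)"
    using C.comp_assoc[OF ep mb t(1)] C.comp_assoc[OF p eb mb] fac[OF b] by simp
  also have "\<dots> = t \<cdot> (amap T p \<cdot> \<theta> a)" using unit_natural[OF p] by (simp add: T_amap)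
  also have "\<dots> = \<mu> a \<cdot> \<eta> a"
    using C.cancel_retraction[OF t(2) Tp t(1) unit_hom[OF a]] fac[OF a] by simp
  finally have "(t \<cdot> \<mu> b) \<cdot> (\<eta> b \<cdot> p) = \<mu> a \<cdot> \<eta> a" .
  from C.orth_diagonal[OF orth(1) ep ma ea tm this]
  obtain w where w: "w \<in> hom C (\<I> b) (\<I> a)" "w \<cdot> (\<eta> b \<cdot> p) = \<eta> a" "\<mu> a \<cdot> w = t \<cdot> \<mu> b" .
  have ia: "Idt C (\<I> a) \<in> hom C (\<I> a) (\<I> a)" and ib: "Idt C (\<I> b) \<in> hom C (\<I> b) (\<I> b)"
    using C.idt_hom C.hom_Obj[OF w(1)] by auto
  have wI: "w \<cdot> amap I p \<in> hom C (\<I> a) (\<I> a)" and Iw: "amap I p \<cdot> w \<in> hom C (\<I> b) (\<I> b)"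
    using C.comp_hom w(1) Ip by blast+
  have "(w \<cdot> amap I p) \<cdot> \<eta> a = Idt C (\<I> a) \<cdot> \<eta> a"
    using C.comp_assoc[OF ea Ip w(1)] eta_natural[OF p] w(2) C.idt_comp[OF ea] by simp
  then have left: "w \<cdot> amap I p = Idt C (\<I> a)"
    using C.is_epiD[OF eta_epi[OF a] ea wI ia] by blast
  have "(amap I p \<cdot> w) \<cdot> (\<eta> b \<cdot> p) = \<eta> b \<cdot> p"
    using C.comp_assoc[OF ep w(1) Ip] w(2) eta_natural[OF p] by simp
  moreover have "\<mu> b \<cdot> (amap I p \<cdot> w) = \<mu> b"
  proof -
    have "\<mu> b \<cdot> (amap I p \<cdot> w) = amap T p \<cdot> (\<mu> a \<cdot> w)"
      using C.comp_assoc[OF w(1) Ip mb] mu_natural[OF p] C.comp_assoc[OF w(1) ma Tp] by simp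
    also have "\<dots> = \<mu> b" using w(3) C.cancel_retraction[OF t(3) t(1) Tp mb] by simp
    finally show ?thesis .
  qed
  ultimately have right: "amap I p \<cdot> w = Idt C (\<I> b)"
    using C.orth_diagonal_unique[OF orth(2) ep mb Iw ib] C.idt_comp[OF ep] C.comp_idt[OF mb] by simp
  show ?thesis by (rule C.is_isoI[OF Ip w(1) left right])
qed

lemma stable_units_iff:
  "stable_units C B I \<eta> \<longleftrightarrow>
    (\<forall>c \<in> Obj C. \<forall>p q g. is_pullback C p q g (\<eta> c) \<longrightarrow> is_iso C (amap I p))"
proof -
  have inv: "p \<in> inverted_by C B I \<longleftrightarrow> is_iso C (amap I p)"
    if "is_pullback C p q g f" for p q g f
    by (rule inverted_by_I_iff[OF C.is_pullback_hom[OF that]])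
  show ?thesis
    unfolding stable_units_def
  proof (rule ball_cong[OF refl])
    fix c assume "c \<in> Obj C"
    show "\<eta> c \<in> largest_pullback_closed C (inverted_by C B I) \<longleftrightarrow>
      (\<forall>p q g. is_pullback C p q g (\<eta> c) \<longrightarrow> is_iso C (amap I p))"
      unfolding C.mem_largest_pullback_closed_iff[OF eta[OF \<open>c \<in> Obj C\<close>]]
      by (intro iff_allI imp_cong refl inv)
  qed
qed

end

theorem theorem2p2:
  fixes C :: "('o, 'a) cat" and X :: "('p, 'b) cat"
    and F :: "('o, 'a, 'p, 'b) functor_data" and G :: "('p, 'b, 'o, 'a) functor_data"
    and \<theta> \<eta> \<mu> :: "'o \<Rightarrow> 'a" and \<I> :: "'o \<Rightarrow> 'o" and \<E> \<M> :: "'a set"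
  assumes "category C" and "has_pullbacks C" and "category X"
    and "is_adjunction C X F G \<theta>"
    and "prefactorization_system C \<E> \<M>"
    and "\<And>c. c \<in> Obj C \<Longrightarrow> \<eta> c \<in> hom C c (\<I> c)"
    and "\<And>c. c \<in> Obj C \<Longrightarrow> \<mu> c \<in> hom C (\<I> c) (omap (G \<circ>\<^sub>F F) c)"
    and "\<And>c. c \<in> Obj C \<Longrightarrow> \<theta> c = \<mu> c \<cdot>\<^bsub>C\<^esub> \<eta> c"
    and "\<And>c. c \<in> Obj C \<Longrightarrow> \<eta> c \<in> \<E>"
    and "\<And>c. c \<in> Obj C \<Longrightarrow> \<mu> c \<in> \<M>"
    and "\<And>c. c \<in> Obj C \<Longrightarrow> is_epi C (\<eta> c)"
  shows
    "let T = G \<circ>\<^sub>F F;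
         I = I_functor C T \<I> \<eta> \<mu>;
         cond_a = (\<forall>c \<in> Obj C. \<forall>g p q. is_pullback C p q g (\<eta> c) \<longrightarrow>
           is_pullback C (amap T p) (amap T q) (amap T g) (amap T (\<eta> c)));
         cond_b = (\<forall>c \<in> Obj C. \<eta> c \<in> largest_pullback_closed C \<E>)
     in (cond_a \<and> cond_b \<longrightarrow> stable_units C (M_subcat C \<M> \<theta>) I \<eta>) \<and>
        (stable_units C (M_subcat C \<M> \<theta>) I \<eta> \<longrightarrow> cond_a)"
proof -
  interpret unit_factorization C X F G \<theta> \<I> \<eta> \<mu> \<E> \<M>
    using assms(4-) by unfold_locales
  let ?a = "\<forall>c \<in> Obj C. \<forall>g p q. is_pullback C p q g (\<eta> c) \<longrightarrow>
    is_pullback C (amap T p) (amap T q) (amap T g) (amap T (\<eta> c))"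
  let ?b = "\<forall>c \<in> Obj C. \<eta> c \<in> largest_pullback_closed C \<E>"
  have sufficient: "?a \<and> ?b \<longrightarrow> stable_units C B I \<eta>"
    unfolding stable_units_iff
  proof (intro impI ballI allI, elim conjE)
    fix c p q g
    assume a: ?a and b: ?b and c: "c \<in> Obj C" and pb: "is_pullback C p q g (\<eta> c)"
    have "p \<in> \<E>"
      using bspec[OF b c] pb unfolding C.mem_largest_pullback_closed_iff[OF eta[OF c]] by blast
    moreover have "is_iso C (amap T p)"
      by (rule C.is_iso_pullback_of_iso[OF a[rule_format, OF c pb] GF_inverts_eta[OF c]])
    ultimately show "is_iso C (amap I p)"
      by (rule I_inverts_E_if_GF_inverts[OF C.is_pullback_hom[OF pb]])
  qed
  have necessary: "stable_units C B I \<eta> \<longrightarrow> ?a"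
    unfolding stable_units_iff
  proof (intro impI ballI allI)
    fix c g p q
    assume "\<forall>c \<in> Obj C. \<forall>p q g. is_pullback C p q g (\<eta> c) \<longrightarrow> is_iso C (amap I p)"
      and c: "c \<in> Obj C" and pb: "is_pullback C p q g (\<eta> c)"
    then have Ip: "is_iso C (amap I p)" by blast
    obtain x y z d where p: "p \<in> hom C d x" and q: "q \<in> hom C d y" and g: "g \<in> hom C x z"
      and e: "\<eta> c \<in> hom C y z" and sq: "g \<cdot>\<^bsub>C\<^esub> p = \<eta> c \<cdot>\<^bsub>C\<^esub> q"
      using pb by (rule C.is_pullbackE)
    have "amap T g \<cdot>\<^bsub>C\<^esub> amap T p = amap T (\<eta> c) \<cdot>\<^bsub>C\<^esub> amap T q"
      using sq F_comp[OF p g] F_comp[OF q e] G_comp[OF F_hom[OF p] F_hom[OF g]]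
        G_comp[OF F_hom[OF q] F_hom[OF e]] by (simp add: T_amap)
    then show "is_pullback C (amap T p) (amap T q) (amap T g) (amap T (\<eta> c))"
      using GF_inverts_inverted_by_I[OF p Ip] GF_inverts_eta[OF c]
      by (rule C.is_pullback_if_parallel_isos[OF T_hom[OF p] T_hom[OF q] T_hom[OF g] T_hom[OF e]])
  qed
  show ?thesis
    unfolding Let_def by (rule conjI[OF sufficient necessary])
qed

end
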